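(* Let $K>k\ge1$ and let $X=(L\sqcup R,E)$ be a finite connected $(K+1,k+1)$-biregular bipartite graph with $|L|=n$ which is an $\varepsilon$-biexpander. Then for all $S,T\subseteq L$, $$\Big|\,|Cl(S,T)|-\Big(\tfrac{Kk+k+1-\varepsilon^2}{n}|S||T|+(\varepsilon^2-1)|S\cap T|\Big)\Big|\le 2\sqrt K\,\varepsilon\sqrt{|S|\big(1-\tfrac{|S|}{n}\big)|T|\big(1-\tfrac{|T|}{n}\big)}.$$
   Context: Left vertices $L$ have degree $K+1$, right vertices $R$ degree $k+1$; $A$ is the adjacency operator, $(Af)(v)=\sum_{u\sim v}f(u)$, and $\mathcal{E}_X=\dim\ker(A|_{L^2(L)})$. $X$ is an $\varepsilon$-biexpander if $\varepsilon<\sqrt K$, $\mathcal{E}_X=0$, and $\mathrm{Spec}(A)\subseteq\{0\}\cup\pm[\sqrt K-\varepsilon,\sqrt K+\varepsilon]\cup\{\pm\sqrt{(K+1)(k+1)}\}$. Viewing each edge as an unordered pair, for $S,T\subseteq L$ the set of clashes is $Cl(S,T)=\{(e,e') : e\in E(S,R),\ e'\in E(T,R),\ e\ne e',\ e\text{ and }e'\text{ share their endpoint in }R\}$, where $E(S,R)$ denotes edges with left endpoint in $S$. *)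

theory Defs
  imports Complex_Main "HOL-Library.Function_Algebras"
begin

definition bipartite_graph :: "'a set \<Rightarrow> 'a set \<Rightarrow> 'a set set \<Rightarrow> bool" where
  "bipartite_graph L R E \<longleftrightarrow> L \<inter> R = {} \<and> E \<subseteq> {{u, v} | u v. u \<in> L \<and> v \<in> R}"

definition vertex_degree :: "'a set set \<Rightarrow> 'a \<Rightarrow> nat" where
  "vertex_degree E v = card {e \<in> E. v \<in> e}"

definition biregular :: "'a set \<Rightarrow> 'a set \<Rightarrow> 'a set set \<Rightarrow> nat \<Rightarrow> nat \<Rightarrow> bool" where
  "biregular L R E a b \<longleftrightarrow>
     (\<forall>v\<in>L. vertex_degree E v = a) \<and> (\<forall>v\<in>R. vertex_degree E v = b)"

definition connected_graph :: "'a set \<Rightarrow> 'a set set \<Rightarrow> bool" where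
  "connected_graph V E \<longleftrightarrow>
     V \<noteq> {} \<and> (\<forall>u\<in>V. \<forall>v\<in>V. (\<lambda>x y. {x, y} \<in> E)\<^sup>*\<^sup>* u v)"

text \<open>For finite \<open>V\<close>, the space \<open>L\<^sup>2(V)\<close> consists of all complex functions on \<open>V\<close>; they are
  extended by zero, so that \<open>L\<^sup>2(W)\<close> is a subspace of \<open>L\<^sup>2(V)\<close> for \<open>W \<subseteq> V\<close>.\<close>

definition L2 :: "'a set \<Rightarrow> ('a \<Rightarrow> complex) set" where
  "L2 V = {f. \<forall>v. v \<notin> V \<longrightarrow> f v = 0}"

definition adjacency_op :: "'a set set \<Rightarrow> ('a \<Rightarrow> complex) \<Rightarrow> 'a \<Rightarrow> complex" where
  "adjacency_op E f v = (\<Sum>u | {u, v} \<in> E. f u)"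

text \<open>As \<open>L\<^sup>2(V)\<close> is finite-dimensional, the spectrum is the set of eigenvalues.\<close>

definition adjacency_spectrum :: "'a set \<Rightarrow> 'a set set \<Rightarrow> complex set" where
  "adjacency_spectrum V E =
     {c. \<exists>f \<in> L2 V. f \<noteq> (\<lambda>_. 0) \<and> adjacency_op E f = (\<lambda>v. c * f v)}"

definition fun_scale :: "complex \<Rightarrow> ('a \<Rightarrow> complex) \<Rightarrow> 'a \<Rightarrow> complex" where
  "fun_scale c f = (\<lambda>v. c * f v)"

global_interpretation fun_space: vector_space "fun_scale :: complex \<Rightarrow> ('a \<Rightarrow> complex) \<Rightarrow> _"
  defines fun_dim = fun_space.dim
  by unfold_locales (simp_all add: fun_scale_def fun_eq_iff algebra_simps)

definition excess :: "'a set \<Rightarrow> 'a set set \<Rightarrow> nat" where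
  "excess L E = fun_dim {f \<in> L2 L. adjacency_op E f = (\<lambda>_. 0)}"

definition biexpander ::
  "'a set \<Rightarrow> 'a set \<Rightarrow> 'a set set \<Rightarrow> nat \<Rightarrow> nat \<Rightarrow> real \<Rightarrow> bool" where
  "biexpander L R E K k \<epsilon> \<longleftrightarrow>
     \<epsilon> < sqrt (real K) \<and>
     excess L E = 0 \<and>
     adjacency_spectrum (L \<union> R) E \<subseteq> complex_of_real `
       ({0} \<union> {sqrt (real K) - \<epsilon> .. sqrt (real K) + \<epsilon>}
            \<union> uminus ` {sqrt (real K) - \<epsilon> .. sqrt (real K) + \<epsilon>}
            \<union> {sqrt ((real K + 1) * (real k + 1)), - sqrt ((real K + 1) * (real k + 1))})"

definition edges_between :: "'a set set \<Rightarrow> 'a set \<Rightarrow> 'a set \<Rightarrow> 'a set set" where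
  "edges_between E S R = {e \<in> E. \<exists>u\<in>S. \<exists>v\<in>R. e = {u, v}}"

definition clashes ::
  "'a set \<Rightarrow> 'a set set \<Rightarrow> 'a set \<Rightarrow> 'a set \<Rightarrow> ('a set \<times> 'a set) set" where
  "clashes R E S T =
     {(e, e'). e \<in> edges_between E S R \<and> e' \<in> edges_between E T R \<and> e \<noteq> e' \<and>
               (\<exists>v\<in>R. v \<in> e \<and> v \<in> e')}"

end

theory Submission
  imports Defs "HOL-Analysis.Function_Topology" "HOL-Analysis.Convex"
begin

text \<open>Counting pairs of edges by their common right endpoint gives
  \<open>|Cl(S,T)| = \<langle>A\<^sup>2 1\<^sub>S, 1\<^sub>T\<rangle> - (K + 1) |S \<inter> T|\<close>. On \<open>L\<^sup>2(L)\<close> the constants form the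
  eigenspace of \<open>A\<^sup>2\<close> for \<open>(K + 1)(k + 1)\<close>, by connectedness, and vanishing excess excludes the
  eigenvalue \<open>0\<close>; hence on the mean-zero functions all eigenvalues of \<open>A\<^sup>2\<close> lie within
  \<open>2 \<surd>K \<epsilon>\<close> of \<open>K + \<epsilon>\<^sup>2\<close>. Replacing \<open>A\<^sup>2\<close> by \<open>K + \<epsilon>\<^sup>2\<close> on the mean-zero parts of \<open>1\<^sub>S\<close> and
  \<open>1\<^sub>T\<close> produces the main term, and Cauchy--Schwarz bounds the error.\<close>

section \<open>Real bilinear form and symmetric kernels on a finite vertex set\<close>

text \<open>Real scalars suffice because the kernel of A^2 is real symmetric. The form is definite
  only on functions that vanish off \<open>L\<close>, so support conditions accompany it
  below.\<close>

definition inner_on :: "'a set \<Rightarrow> ('a \<Rightarrow> real) \<Rightarrow> ('a \<Rightarrow> real) \<Rightarrow> real" where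
  "inner_on L f g = (\<Sum>v\<in>L. f v * g v)"

text \<open>Cutting off outside \<open>L\<close> keeps the image supported on \<open>L\<close>, so
  eigenvalue equations can be stated as equalities of total functions.\<close>

definition kernel_op :: "'a set \<Rightarrow> ('a \<Rightarrow> 'a \<Rightarrow> real) \<Rightarrow> ('a \<Rightarrow> real) \<Rightarrow> 'a \<Rightarrow> real" where
  "kernel_op L m f v = (if v \<in> L then \<Sum>u\<in>L. m v u * f u else 0)"

lemma inner_on_commute: "inner_on L f g = inner_on L g f"
  by (simp add: inner_on_def mult.commute)

text \<open>One two-term pattern covers sums, differences and multiples; later terms carry explicit
  coefficients 1, -1 or 0 in order to match it.\<close>

lemma inner_on_lin:
  "inner_on L (\<lambda>v. a * f v + b * g v) h = a * inner_on L f h + b * inner_on L g h"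
  "inner_on L h (\<lambda>v. a * f v + b * g v) = a * inner_on L h f + b * inner_on L h g"
  by (simp_all add: inner_on_def sum.distrib sum_distrib_left algebra_simps)

lemma inner_on_ge_0: "inner_on L f f \<ge> 0"
  by (simp add: inner_on_def sum_nonneg)

lemma inner_on_eq_0:
  assumes "finite L" "inner_on L f f = 0" "v \<in> L"
  shows "f v = 0"
  using assms by (simp add: inner_on_def sum_nonneg_eq_0_iff)

lemma inner_on_Cauchy_Schwarz:
  "\<bar>inner_on L f g\<bar> \<le> sqrt (inner_on L f f * inner_on L g g)"
proof -
  have "(inner_on L f g)\<^sup>2 \<le> inner_on L f f * inner_on L g g"
    using Cauchy_Schwarz_ineq_sum[of f g L] by (simp add: inner_on_def power2_eq_square)
  then show ?thesis
    by (metis real_sqrt_abs real_sqrt_le_iff)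
qed

lemma kernel_op_lin:
  "kernel_op L m (\<lambda>v. a * f v + b * g v) = (\<lambda>v. a * kernel_op L m f v + b * kernel_op L m g v)"
  by (auto simp: kernel_op_def fun_eq_iff sum.distrib sum_distrib_left algebra_simps)

lemma inner_on_kernel_op:
  assumes "\<And>u v. m u v = m v u"
  shows "inner_on L (kernel_op L m f) g = inner_on L f (kernel_op L m g)"
proof -
  have "inner_on L (kernel_op L m f) g = (\<Sum>v\<in>L. \<Sum>u\<in>L. m v u * f u * g v)"
    by (simp add: inner_on_def kernel_op_def sum_distrib_right)
  also have "\<dots> = (\<Sum>u\<in>L. \<Sum>v\<in>L. m v u * f u * g v)"
    by (rule sum.swap)
  also have "\<dots> = inner_on L f (kernel_op L m g)"
    by (simp add: inner_on_def kernel_op_def sum_distrib_left assms mult_ac)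
  finally show ?thesis .
qed

section \<open>Operator bound from eigenvalues by a variational argument\<close>

text \<open>Tychonoff's theorem: coordinates off \<open>L\<close> range over the singleton {0}, so
  the box is compact even when the type \<open>'a\<close> is infinite. It will contain the unit
  sphere of \<open>W\<close>.\<close>

lemma compact_supported_box:
  fixes L :: "'a set"
  shows "compact {f :: 'a \<Rightarrow> real. \<forall>v. if v \<in> L then \<bar>f v\<bar> \<le> 1 else f v = 0}"
proof -
  define C :: "'a \<Rightarrow> real set" where "C v = (if v \<in> L then {-1..1} else {0})" for v
  have "compactin (product_topology (\<lambda>_. euclidean) UNIV) (PiE UNIV C)"
    unfolding compactin_PiE by (auto simp: C_def)
  then have "compact (PiE UNIV C)"
    by (simp add: euclidean_product_topology)
  moreover have "f \<in> PiE UNIV C \<longleftrightarrow> (\<forall>v. if v \<in> L then \<bar>f v\<bar> \<le> 1 else f v = 0)" for f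
    by (auto simp: PiE_iff C_def abs_le_iff split: if_splits)
  then have "PiE UNIV C = {f. \<forall>v. if v \<in> L then \<bar>f v\<bar> \<le> 1 else f v = 0}"
    by blast
  ultimately show ?thesis by simp
qed

lemma continuous_on_inner_on:
  assumes "\<And>v. v \<in> L \<Longrightarrow> continuous_on X (\<lambda>f. F f v)" "\<And>v. v \<in> L \<Longrightarrow> continuous_on X (\<lambda>f. G f v)"
  shows "continuous_on X (\<lambda>f. inner_on L (F f) (G f))"
  unfolding inner_on_def using assms by (intro continuous_intros) auto

lemma continuous_on_eval: "continuous_on X (\<lambda>f :: 'a \<Rightarrow> real. f v)"
  by (rule continuous_on_subset[OF continuous_on_product_coordinates]) simp

lemma continuous_on_kernel_op: "continuous_on X (\<lambda>f. kernel_op L m f v)"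
  unfolding kernel_op_def
  by (cases "v \<in> L") (simp_all only: if_True if_False continuous_on_const continuous_on_sum continuous_on_mult_left continuous_on_eval)

text \<open>A maximiser \<open>f\<close> of \<open>\<parallel>Mf\<parallel>\<^sup>2\<close> on the unit sphere of \<open>W\<close>, with maximum \<open>\<lambda>\<close>, satisfies
  \<open>M\<^sup>2 f = \<lambda> f\<close> by first variation; then \<open>f\<close> or \<open>M f + \<surd>\<lambda> f\<close> is an eigenvector of \<open>M\<close> for
  \<open>\<plusminus>\<surd>\<lambda>\<close>.\<close>

lemma kernel_op_bound:
  fixes L :: "'a set" and W :: "('a \<Rightarrow> real) set"
  assumes fin: "finite L" and sym: "\<And>u v. m u v = m v u"
    and supp: "\<And>f v. f \<in> W \<Longrightarrow> v \<notin> L \<Longrightarrow> f v = 0"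
    and closed: "closed W"
    and lin: "\<And>a b f g. f \<in> W \<Longrightarrow> g \<in> W \<Longrightarrow> (\<lambda>v. a * f v + b * g v) \<in> W"
    and inv: "\<And>f. f \<in> W \<Longrightarrow> kernel_op L m f \<in> W"
    and eig: "\<And>f c. f \<in> W \<Longrightarrow> f \<noteq> (\<lambda>_. 0) \<Longrightarrow> kernel_op L m f = (\<lambda>v. c * f v) \<Longrightarrow> \<bar>c\<bar> \<le> r"
    and f: "f \<in> W" and g: "g \<in> W"
  shows "\<bar>inner_on L (kernel_op L m f) g\<bar> \<le> r * sqrt (inner_on L f f * inner_on L g g)"
proof (cases "inner_on L f f = 0")
  \<comment> \<open>Here both sides are 0. In the other case \<open>f\<close> can be normalised,
    which makes the unit sphere nonempty.\<close>
  case True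
  have "f v = 0" if "v \<in> L" for v
    by (rule inner_on_eq_0[OF fin True that])
  then show ?thesis
    by (simp add: True inner_on_def kernel_op_def)
next
  case False
  let ?M = "kernel_op L m"
  define N where "N f = inner_on L (?M f) (?M f)" for f
  have zero: "h = (\<lambda>_. 0)" if "h \<in> W" "inner_on L h h = 0" for h
    using inner_on_eq_0[OF fin that(2)] supp[OF that(1)] by auto
  have scale: "(\<lambda>v. a * h v) \<in> W" if "h \<in> W" for a h
    using lin[OF that that, of a 0] by simp
  have inner_scale: "inner_on L (\<lambda>v. a * h v) (\<lambda>v. a * h v) = a\<^sup>2 * inner_on L h h" for a h
    by (simp add: inner_on_def sum_distrib_left power2_eq_square algebra_simps)
  have N_scale: "N (\<lambda>v. a * h v) = a\<^sup>2 * N h" for a h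
    using kernel_op_lin[of L m a h 0 h] inner_scale by (simp add: N_def)
  define Sph where "Sph = W \<inter> {f. inner_on L f f = 1}"
  have normalise: "(\<lambda>v. 1 / sqrt (inner_on L h h) * h v) \<in> Sph"
    if "h \<in> W" "inner_on L h h \<noteq> 0" for h
  proof -
    have "inner_on L h h > 0" using that(2) inner_on_ge_0[of L h] by simp
    then show ?thesis
      unfolding Sph_def mem_Collect_eq Int_iff inner_scale
      by (intro conjI scale[OF that(1)]) (simp add: power_divide)
  qed
  have "closed Sph"
    unfolding Sph_def
    by (intro closed_Int closed closed_Collect_eq continuous_on_inner_on continuous_on_eval
          continuous_on_const)
  have "\<bar>h v\<bar> \<le> 1" if "h \<in> Sph" "v \<in> L" for h v
  proof -
    have "h v * h v \<le> inner_on L h h"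
      unfolding inner_on_def using fin that by (intro member_le_sum) auto
    also have "\<dots> = 1" using that by (simp add: Sph_def)
    finally show ?thesis
      by (simp add: abs_square_le_1 flip: power2_eq_square)
  qed
  then have "Sph \<subseteq> {f. \<forall>v. if v \<in> L then \<bar>f v\<bar> \<le> 1 else f v = 0}"
    using supp by (auto simp: Sph_def)
  then have "compact Sph"
    using closed_Int_compact[OF \<open>closed Sph\<close> compact_supported_box[of L]] by (simp add: Int_absorb2)
  moreover have "Sph \<noteq> {}"
    using normalise[OF f False] by auto
  moreover have "continuous_on Sph N"
    unfolding N_def by (intro continuous_on_inner_on continuous_on_kernel_op)
  ultimately obtain p where p: "p \<in> Sph" and pmax: "\<And>h. h \<in> Sph \<Longrightarrow> N h \<le> N p"
    using continuous_attains_sup[of Sph N] by blast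
  define l where "l = N p"
  have pW: "p \<in> W" and p1: "inner_on L p p = 1"
    using p by (auto simp: Sph_def)
  have l0: "l \<ge> 0"
    by (simp add: l_def N_def inner_on_ge_0)
  \<comment> \<open>Both sides are homogeneous of degree 2, so the maximum on the sphere bounds
    \<open>N\<close> on all of \<open>W\<close>.\<close>
  have le: "N h \<le> l * inner_on L h h" if "h \<in> W" for h
  proof (cases "inner_on L h h = 0")
    case True
    have "h = (\<lambda>_. 0)" by (rule zero[OF that True])
    then show ?thesis by (simp add: N_def inner_on_def kernel_op_def)
  next
    case False
    then have "inner_on L h h > 0" using inner_on_ge_0[of L h] by simp
    then show ?thesis
      using pmax[OF normalise[OF that False]]
      unfolding N_scale l_def by (simp add: power_divide field_simps)
  qed
  \<comment> \<open>This is half the gradient at \<open>p\<close> of the functional l <g,g> - N(g),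
    which is nonnegative on \<open>W\<close> and vanishes at \<open>p\<close>. The aim is
    \<open>h = 0\<close>.\<close>
  define h where "h = (\<lambda>v. l * p v + (-1) * ?M (?M p) v)"
  have hW: "h \<in> W"
    unfolding h_def by (intro lin inv pW)
  define a where "a = inner_on L h h"
  define q where "q = l * a - N h"
  have q0: "q \<ge> 0" using le[OF hW] by (simp add: q_def a_def)
  have a_eq: "a = l * inner_on L p h - inner_on L (?M p) (?M h)"
  proof -
    have "a = inner_on L (\<lambda>v. l * p v + (-1) * ?M (?M p) v) h"
      unfolding a_def by (simp only: h_def)
    also have "\<dots> = l * inner_on L p h + (-1) * inner_on L (?M (?M p)) h"
      by (rule inner_on_lin)
    also have "inner_on L (?M (?M p)) h = inner_on L (?M p) (?M h)"
      by (rule inner_on_kernel_op[OF sym])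
    finally show ?thesis by simp
  qed
  \<comment> \<open>The left side is the value of that functional at \<open>p + t h\<close>: its
    constant term vanishes and \<open>a\<close> is half its linear coefficient.\<close>
  have var: "2 * t * a + t\<^sup>2 * q \<ge> 0" for t
  proof -
    let ?g = "\<lambda>v. 1 * p v + t * h v"
    have "N ?g \<le> l * inner_on L ?g ?g"
      by (intro le lin pW hW)
    moreover have "N ?g = l + 2 * t * inner_on L (?M p) (?M h) + t\<^sup>2 * N h"
      unfolding N_def l_def kernel_op_lin inner_on_lin
      using inner_on_commute[of L "?M p" "?M h"] by (simp add: power2_eq_square algebra_simps)
    moreover have "inner_on L ?g ?g = 1 + 2 * t * inner_on L p h + t\<^sup>2 * a"
      unfolding inner_on_lin a_def
      using inner_on_commute[of L p h] p1 by (simp add: power2_eq_square algebra_simps)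
    ultimately have "l + 2 * t * inner_on L (?M p) (?M h) + t\<^sup>2 * N h
        \<le> l * (1 + 2 * t * inner_on L p h + t\<^sup>2 * a)"
      by (simp only:)
    moreover have "2 * t * a = 2 * t * (l * inner_on L p h - inner_on L (?M p) (?M h))"
      using a_eq by simp
    ultimately show ?thesis
      unfolding q_def by (simp add: algebra_simps)
  qed
  have "a = 0"
  proof (rule ccontr)
    assume "a \<noteq> 0"
    \<comment> \<open>The denominator is \<open>q + 1\<close> because \<open>q\<close> may be 0; the
      quadratic then takes the negative value -t^2 (q + 2).\<close>
    define t where "t = - a / (q + 1)"
    have a_t: "a = - t * (q + 1)" using q0 by (simp add: t_def)
    have "2 * t * a + t\<^sup>2 * q = - (t\<^sup>2 * (q + 2))"
      unfolding a_t by (simp add: power2_eq_square algebra_simps)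
    moreover have "t\<^sup>2 * (q + 2) > 0"
      using q0 \<open>a \<noteq> 0\<close> by (simp add: t_def)
    ultimately show False
      using var[of t] by simp
  qed
  then have "h = (\<lambda>_. 0)" using zero[OF hW] by (simp add: a_def)
  then have MM: "?M (?M p) = (\<lambda>v. l * p v)"
    by (auto simp: h_def fun_eq_iff)
  have pn: "p \<noteq> (\<lambda>_. 0)" using p1 by (auto simp: inner_on_def)
  define s where "s = sqrt l"
  have s2: "s * s = l" using l0 by (simp add: s_def)
  define e where "e = (\<lambda>v. 1 * ?M p v + s * p v)"
  have sr: "s \<le> r"
  proof (cases "e = (\<lambda>_. 0)")
    case True
    then have "?M p = (\<lambda>v. (- s) * p v)"
      by (auto simp: e_def fun_eq_iff eq_neg_iff_add_eq_0)
    from eig[OF pW pn this] show ?thesis by simp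
  next
    case False
    have "?M e = (\<lambda>v. s * e v)"
      unfolding e_def kernel_op_lin MM by (simp add: fun_eq_iff algebra_simps s2[symmetric])
    moreover have "e \<in> W" unfolding e_def by (intro lin inv pW)
    ultimately have "\<bar>s\<bar> \<le> r" using eig[OF _ False] by blast
    then show ?thesis by simp
  qed
  have "s \<ge> 0" using l0 by (simp add: s_def)
  have "\<bar>inner_on L (?M f) g\<bar> \<le> sqrt (N f * inner_on L g g)"
    unfolding N_def by (rule inner_on_Cauchy_Schwarz)
  also have "\<dots> \<le> sqrt (l * inner_on L f f * inner_on L g g)"
    by (intro real_sqrt_le_mono mult_right_mono le f inner_on_ge_0)
  also have "\<dots> = s * sqrt (inner_on L f f * inner_on L g g)"
    by (simp add: s_def real_sqrt_mult)
  also have "\<dots> \<le> r * sqrt (inner_on L f f * inner_on L g g)"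
    using sr by (intro mult_right_mono) (auto simp: inner_on_ge_0)
  finally show ?thesis .
qed

section \<open>Vanishing excess as a trivial kernel\<close>

text \<open>The cardinality of an infinite basis would also be 0, so dimension 0 must be combined
  with finiteness: the basis lies in the span of the point indicators of \<open>L\<close>, hence is
  finite, hence empty.\<close>

lemma excess_eq_0D:
  assumes fin: "finite L" and ex: "excess L E = 0"
    and f: "f \<in> L2 L" "adjacency_op E f = (\<lambda>_. 0)"
  shows "f = (\<lambda>_. 0)"
proof -
  define Z where "Z = {f \<in> L2 L. adjacency_op E f = (\<lambda>_. 0)}"
  obtain B where B: "B \<subseteq> Z" "\<not> fun_space.dependent B" "Z \<subseteq> fun_space.span B" "card B = fun_dim Z"
    using fun_space.basis_exists by blast
  define D :: "('a \<Rightarrow> complex) set" where "D = (\<lambda>u v. if v = u then 1 else 0) ` L"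
  have "g \<in> fun_space.span D" if "g \<in> L2 L" for g
  proof -
    have sum_apply: "(\<Sum>u\<in>A. F u) v = (\<Sum>u\<in>A. F u v)" for A v and F :: "'a \<Rightarrow> 'a \<Rightarrow> complex"
      by (induction A rule: infinite_finite_induct) auto
    have "g = (\<Sum>u\<in>L. fun_scale (g u) (\<lambda>v. if v = u then 1 else 0))"
      using that fin by (auto simp: fun_eq_iff sum_apply fun_scale_def L2_def if_distrib cong: if_cong)
    also have "\<dots> \<in> fun_space.span D"
      by (intro fun_space.span_sum fun_space.span_scale fun_space.span_base) (auto simp: D_def)
    finally show ?thesis .
  qed
  then have "B \<subseteq> fun_space.span D"
    using B(1) by (auto simp: Z_def)
  moreover have "finite D" using fin by (simp add: D_def)
  ultimately have "finite B"
    using fun_space.independent_span_bound B(2) by blast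
  then have "B = {}"
    using B(4) ex by (simp add: excess_def Z_def)
  then have "Z \<subseteq> {0}" using B(3) by simp
  then show ?thesis
    using f by (auto simp: Z_def zero_fun_def)
qed

section \<open>Degrees and codegrees in a biregular bipartite graph\<close>

text \<open>An edge at \<open>v\<close> is determined by its other endpoint. The set
  \<open>B\<close> is left general to serve for both sides of the bipartition.\<close>

lemma vertex_degree_eq_card:
  assumes "v \<notin> B" and "\<And>e. e \<in> E \<Longrightarrow> v \<in> e \<Longrightarrow> \<exists>w\<in>B. e = {v, w}"
  shows "vertex_degree E v = card {w \<in> B. {v, w} \<in> E}"
proof -
  have "bij_betw (\<lambda>w. {v, w}) {w \<in> B. {v, w} \<in> E} {e \<in> E. v \<in> e}"
    using assms by (auto simp: bij_betw_def inj_on_def doubleton_eq_iff image_iff) 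
  then show ?thesis
    by (simp add: vertex_degree_def bij_betw_same_card)
qed

locale biregular_bipartite =
  fixes L R :: "'a set" and E :: "'a set set" and K k :: nat
  assumes fin_L: "finite L" and fin_R: "finite R"
    and bipartite: "bipartite_graph L R E"
    and regular: "biregular L R E (K + 1) (k + 1)"
begin

definition adj :: "'a \<Rightarrow> 'a \<Rightarrow> real" where
  "adj u w = of_bool ({u, w} \<in> E)"

text \<open>The number of common neighbours, which is the matrix of A^2 on functions on
  \<open>L\<close>.\<close>

definition codeg :: "'a \<Rightarrow> 'a \<Rightarrow> real" where
  "codeg u v = (\<Sum>w\<in>R. adj u w * adj v w)"

lemma disjoint: "v \<in> L \<Longrightarrow> v \<in> R \<Longrightarrow> False"
  using bipartite by (auto simp: bipartite_graph_def)

lemma edge_cases: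
  assumes "e \<in> E"
  obtains u w where "u \<in> L" "w \<in> R" "e = {u, w}"
  using assms bipartite by (auto simp: bipartite_graph_def)

lemma nbr_of_L: "{u, w} \<in> E \<Longrightarrow> u \<in> L \<Longrightarrow> w \<in> R"
  using disjoint by (elim edge_cases) (auto simp: doubleton_eq_iff)

lemma nbr_of_R: "{u, w} \<in> E \<Longrightarrow> w \<in> R \<Longrightarrow> u \<in> L"
  using disjoint by (elim edge_cases) (auto simp: doubleton_eq_iff)

lemma degree_L:
  assumes "u \<in> L"
  shows "(\<Sum>w\<in>R. adj u w) = real K + 1"
proof -
  have "\<exists>w\<in>R. e = {u, w}" if "e \<in> E" "u \<in> e" for e
    using that assms disjoint by (elim edge_cases) auto
  then have "vertex_degree E u = card {w \<in> R. {u, w} \<in> E}"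
    using assms disjoint by (intro vertex_degree_eq_card) auto
  moreover have "vertex_degree E u = K + 1"
    using regular assms by (simp add: biregular_def)
  ultimately show ?thesis
    using fin_R by (simp add: adj_def sum_of_bool_eq Int_def)
qed

lemma degree_R:
  assumes "w \<in> R"
  shows "(\<Sum>u\<in>L. adj u w) = real k + 1"
proof -
  have "\<exists>u\<in>L. e = {w, u}" if "e \<in> E" "w \<in> e" for e
    using that assms disjoint by (elim edge_cases) auto
  then have "vertex_degree E w = card {u \<in> L. {w, u} \<in> E}"
    using assms disjoint by (intro vertex_degree_eq_card) auto
  moreover have "vertex_degree E w = k + 1"
    using regular assms by (simp add: biregular_def)
  ultimately show ?thesis
    using fin_L by (simp add: adj_def sum_of_bool_eq Int_def insert_commute)
qed

lemma codeg_commute: "codeg u v = codeg v u"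
  by (simp add: codeg_def mult.commute)

lemma codeg_nonneg: "codeg u v \<ge> 0"
  by (simp add: codeg_def adj_def sum_nonneg)

lemma codeg_self: "u \<in> L \<Longrightarrow> codeg u u = real K + 1"
  by (simp add: codeg_def degree_L[symmetric] adj_def flip: of_bool_conj)

text \<open>Walks of length two from \<open>u\<close>, including those that return to
  \<open>u\<close>, are counted by their midpoint. Hence constants on \<open>L\<close> are
  eigenvectors of A^2.\<close>

lemma codeg_row_sum:
  assumes "u \<in> L"
  shows "(\<Sum>v\<in>L. codeg u v) = (real K + 1) * (real k + 1)"
proof -
  have "(\<Sum>v\<in>L. codeg u v) = (\<Sum>w\<in>R. \<Sum>v\<in>L. adj u w * adj v w)"
    unfolding codeg_def by (rule sum.swap)
  also have "\<dots> = (\<Sum>w\<in>R. adj u w * (real k + 1))"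
    by (intro sum.cong) (simp_all add: degree_R flip: sum_distrib_left)
  finally show ?thesis
    by (simp add: degree_L assms flip: sum_distrib_right)
qed

text \<open>Neighbours of a vertex lie on the opposite side, so the sum over all neighbours becomes
  a weighted sum over one finite side; vertices outside the graph have no neighbours.\<close>

lemma adjacency_op_eq:
  "adjacency_op E F v =
     (if v \<in> L then \<Sum>w\<in>R. of_real (adj v w) * F w
      else if v \<in> R then \<Sum>u\<in>L. of_real (adj u v) * F u else 0)"
proof -
  have *: "(\<Sum>u | {u, v} \<in> E. F u) = (\<Sum>u\<in>A. of_bool ({u, v} \<in> E) * F u)"
    if "finite A" "{u. {u, v} \<in> E} \<subseteq> A" for A
    using that by (intro sum.mono_neutral_cong_left) auto
  have of_real: "complex_of_real (of_bool P) = of_bool P" for P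
    by simp
  consider "v \<in> L" | "v \<in> R" | "v \<notin> L" "v \<notin> R" by blast
  then show ?thesis
  proof cases
    case 1
    then have "{u. {u, v} \<in> E} \<subseteq> R"
      using nbr_of_L by (auto simp: insert_commute)
    from *[OF fin_R this] 1 show ?thesis
      by (simp add: adjacency_op_def adj_def insert_commute of_real)
  next
    case 2
    then have "{u. {u, v} \<in> E} \<subseteq> L"
      using nbr_of_R by auto
    from *[OF fin_L this] 2 show ?thesis
      using disjoint by (auto simp: adjacency_op_def adj_def of_real)
  next
    case 3
    then have "{u. {u, v} \<in> E} = {}"
      by (auto elim: edge_cases simp: doubleton_eq_iff)
    with 3 show ?thesis
      by (simp add: adjacency_op_def)
  qed
qed

section \<open>Eigenvalues of the codegree operator\<close>

text \<open>Exchanging the sums factors the codegree operator through functions on \<open>R\<close>,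
  exhibiting it as A applied twice.\<close>

lemma kernel_op_codeg:
  assumes "v \<in> L"
  shows "kernel_op L codeg f v = (\<Sum>w\<in>R. adj v w * (\<Sum>u\<in>L. adj u w * f u))"
proof -
  have "kernel_op L codeg f v = (\<Sum>u\<in>L. \<Sum>w\<in>R. adj v w * (adj u w * f u))"
    using assms by (simp add: kernel_op_def codeg_def sum_distrib_right mult.assoc)
  also have "\<dots> = (\<Sum>w\<in>R. \<Sum>u\<in>L. adj v w * (adj u w * f u))"
    by (rule sum.swap)
  finally show ?thesis
    by (simp add: sum_distrib_left)
qed

text \<open>If \<open>A\<^sup>2 f = s\<^sup>2 f\<close> with \<open>f\<close> supported on \<open>L\<close> and \<open>s \<noteq> 0\<close>, then \<open>f + s\<^sup>-\<^sup>1 A f\<close> is an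
  eigenvector of \<open>A\<close> for \<open>s\<close>.\<close>

lemma codeg_eigenvalue:
  assumes ex: "excess L E = 0"
    and supp: "\<And>v. v \<notin> L \<Longrightarrow> f v = 0" and nz: "f \<noteq> (\<lambda>_. 0)"
    and eig: "kernel_op L codeg f = (\<lambda>v. \<mu> * f v)"
  obtains s where "s > 0" "\<mu> = s\<^sup>2" "complex_of_real s \<in> adjacency_spectrum (L \<union> R) E"
proof -
  \<comment> \<open>\<open>F\<close> and \<open>H\<close> are the complex versions of f and Af,
    since the spectrum is defined on complex functions; \<open>h\<close> keeps Af real for the sign
    argument.\<close>
  define F where "F v = complex_of_real (f v)" for v
  define h where "h w = (if w \<in> R then \<Sum>u\<in>L. adj u w * f u else 0)" for w
  define H where "H w = complex_of_real (h w)" for w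
  have AF: "adjacency_op E F = H"
  proof
    fix v
    have "f w = 0" if "w \<in> R" for w
      using that supp disjoint by blast
    then show "adjacency_op E F v = H v"
      using disjoint by (auto simp: adjacency_op_eq F_def H_def h_def)
  qed
  have Ah: "(\<Sum>w\<in>R. adj v w * h w) = \<mu> * f v" if "v \<in> L" for v
    using kernel_op_codeg[OF that, of f] eig by (simp add: h_def)
  have AH: "adjacency_op E H = (\<lambda>v. of_real \<mu> * F v)"
  proof
    fix v
    have "(\<Sum>w\<in>R. of_real (adj v w) * H w) = of_real \<mu> * F v" if "v \<in> L"
      using arg_cong[OF Ah[OF that], of complex_of_real] by (simp add: H_def F_def)
    moreover have "H u = 0" if "u \<in> L" for u
      using that disjoint by (auto simp: H_def h_def)
    ultimately show "adjacency_op E H v = of_real \<mu> * F v"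
      using supp by (simp add: adjacency_op_eq F_def)
  qed
  \<comment> \<open>Symmetry of A gives \<mu> <f,f> = <Af,Af>, so \<mu> cannot be negative.\<close>
  have "\<mu> * inner_on L f f = (\<Sum>v\<in>L. (\<Sum>w\<in>R. adj v w * h w) * f v)"
    unfolding inner_on_def sum_distrib_left by (intro sum.cong refl) (simp add: Ah mult.assoc)
  also have "\<dots> = (\<Sum>v\<in>L. \<Sum>w\<in>R. adj v w * h w * f v)"
    by (simp only: sum_distrib_right)
  also have "\<dots> = (\<Sum>w\<in>R. \<Sum>v\<in>L. adj v w * h w * f v)"
    by (rule sum.swap)
  also have "\<dots> = inner_on R h h"
    unfolding inner_on_def
    by (intro sum.cong refl) (simp add: h_def sum_distrib_left sum_distrib_right mult_ac)
  finally have \<mu>: "\<mu> * inner_on L f f = inner_on R h h" .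
  have fpos: "inner_on L f f > 0"
    using inner_on_ge_0[of L f] inner_on_eq_0[OF fin_L, of f] nz supp by (metis order_le_less ext)
  have "\<mu> \<ge> 0"
    using \<mu> fpos inner_on_ge_0[of R h] by (metis not_less mult_neg_pos)
  moreover have "\<mu> \<noteq> 0"
  \<comment> \<open>If \<mu> were 0, the same identity would give Af = 0, placing f in the kernel
    that zero excess makes trivial.\<close>
  proof
    assume "\<mu> = 0"
    then have "h w = 0" for w
      using \<mu> inner_on_eq_0[OF fin_R, of h w] by (cases "w \<in> R") (auto simp: h_def)
    then have "adjacency_op E F = (\<lambda>_. 0)"
      unfolding AF by (simp add: H_def fun_eq_iff)
    moreover have "F \<in> L2 L"
      using supp by (simp add: L2_def F_def)
    ultimately have "F = (\<lambda>_. 0)"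
      using excess_eq_0D fin_L ex by blast
    then show False
      using nz by (simp add: F_def fun_eq_iff)
  qed
  ultimately have mpos: "\<mu> > 0" by simp
  define s where "s = sqrt \<mu>"
  have s: "s > 0" "\<mu> = s * s" using mpos by (auto simp: s_def)
  define G where "G v = F v + H v / of_real s" for v
  have "adjacency_op E G = (\<lambda>v. adjacency_op E F v + adjacency_op E H v / of_real s)"
    by (rule ext) (simp add: adjacency_op_def G_def sum.distrib sum_divide_distrib)
  also have "\<dots> = (\<lambda>v. of_real s * G v)"
    unfolding AF AH using s by (auto simp: G_def field_simps)
  finally have "adjacency_op E G = (\<lambda>v. of_real s * G v)" .
  moreover have "G \<in> L2 (L \<union> R)"
    using supp by (simp add: L2_def G_def F_def H_def h_def)
  moreover have "G \<noteq> (\<lambda>_. 0)"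
  proof
    assume G: "G = (\<lambda>_. 0)"
    have "f v = 0" if "v \<in> L" for v
    proof -
      have "H v = 0"
        using disjoint[OF that] by (auto simp: H_def h_def)
      then show "f v = 0"
        using fun_cong[OF G, of v] by (simp add: G_def F_def)
    qed
    then show False using nz supp by auto
  qed
  ultimately have "complex_of_real s \<in> adjacency_spectrum (L \<union> R) E"
    by (auto simp: adjacency_spectrum_def)
  then show ?thesis
    using that s by (simp add: power2_eq_square)
qed

text \<open>The Dirichlet form \<open>\<Sum> b(u,v) (f(u) - f(v))\<^sup>2\<close> of a top eigenvector \<open>f\<close> vanishes.\<close>

lemma top_eigenvector_const:
  assumes conn: "connected_graph (L \<union> R) E"
    and eig: "\<And>v. v \<in> L \<Longrightarrow> kernel_op L codeg f v = (real K + 1) * (real k + 1) * f v"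
    and "u \<in> L" "v \<in> L"
  shows "f v = f u"
proof -
  let ?D = "(real K + 1) * (real k + 1)"
  \<comment> \<open>After expansion, both square terms equal \<open>?D\<close> times the squared
    norm of f by the row sums, and the cross sum has the same value by the eigenvalue equation. They
    cancel.\<close>
  have "(\<Sum>u\<in>L. \<Sum>v\<in>L. codeg u v * (f u - f v)\<^sup>2) =
      (\<Sum>u\<in>L. \<Sum>v\<in>L. codeg u v * (f u)\<^sup>2) + (\<Sum>u\<in>L. \<Sum>v\<in>L. codeg u v * (f v)\<^sup>2)
        - 2 * (\<Sum>u\<in>L. \<Sum>v\<in>L. codeg u v * f v * f u)"
    by (simp add: power2_diff algebra_simps sum.distrib sum_subtractf sum_distrib_left)
  also have "(\<Sum>u\<in>L. \<Sum>v\<in>L. codeg u v * (f v)\<^sup>2) = (\<Sum>v\<in>L. \<Sum>u\<in>L. codeg v u * (f v)\<^sup>2)"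
    by (subst sum.swap) (simp add: codeg_commute)
  also have "(\<Sum>u\<in>L. \<Sum>v\<in>L. codeg u v * (f u)\<^sup>2) = (\<Sum>u\<in>L. ?D * (f u)\<^sup>2)"
    by (simp add: codeg_row_sum flip: sum_distrib_right)
  also have "(\<Sum>u\<in>L. \<Sum>v\<in>L. codeg u v * f v * f u) = (\<Sum>u\<in>L. ?D * (f u)\<^sup>2)"
  proof (intro sum.cong refl)
    fix u assume "u \<in> L"
    then have "(\<Sum>v\<in>L. codeg u v * f v) = ?D * f u"
      using eig[of u] by (simp add: kernel_op_def)
    then have "(\<Sum>v\<in>L. codeg u v * f v) * f u = ?D * (f u)\<^sup>2"
      by (simp add: power2_eq_square)
    then show "(\<Sum>v\<in>L. codeg u v * f v * f u) = ?D * (f u)\<^sup>2"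
      by (simp only: sum_distrib_right)
  qed
  finally have z: "(\<Sum>u\<in>L. \<Sum>v\<in>L. codeg u v * (f u - f v)\<^sup>2) = 0"
    by simp
  \<comment> \<open>A vanishing sum of nonnegative terms has only zero terms, and a common neighbour
    makes the weight positive.\<close>
  have common_nbr: "f y = f x" if "{x, w} \<in> E" "{y, w} \<in> E" "x \<in> L" "y \<in> L" for x y w
  proof -
    have "codeg x y * (f x - f y)\<^sup>2 = 0"
      using z fin_L that(3,4) codeg_nonneg by (simp add: sum_nonneg_eq_0_iff sum_nonneg)
    moreover have "codeg x y > 0"
      unfolding codeg_def
      using that nbr_of_L fin_R by (intro sum_pos2[of _ w]) (auto simp: adj_def)
    ultimately show ?thesis by simp
  qed
  have "(\<lambda>x y. {x, y} \<in> E)\<^sup>*\<^sup>* u v"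
    using conn assms by (simp add: connected_graph_def)
  \<comment> \<open>A path alternates between the sides while f matters only on \<open>L\<close>; at
    a vertex of \<open>R\<close> the invariant therefore speaks of all its neighbours.\<close>
  then have "(v \<in> L \<longrightarrow> f v = f u) \<and> (v \<in> R \<longrightarrow> (\<forall>y. {y, v} \<in> E \<longrightarrow> f y = f u))"
  proof (induction rule: rtranclp_induct)
    case base
    then show ?case using \<open>u \<in> L\<close> disjoint by auto
  next
    case (step y z)
    show ?case
    proof (intro conjI impI allI)
      assume "z \<in> L"
      then have "{z, y} \<in> E" "y \<in> R"
        using step.hyps(2) nbr_of_L by (auto simp: insert_commute)
      then show "f z = f u" using step.IH by blast
    next
      fix x assume "z \<in> R" "{x, z} \<in> E"
      then have "x \<in> L" "y \<in> L"
        using step.hyps(2) nbr_of_R by auto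
      then have "f y = f u" using step.IH by blast
      moreover have "f x = f y"
        using common_nbr \<open>{x, z} \<in> E\<close> \<open>x \<in> L\<close> \<open>y \<in> L\<close> step.hyps(2) by blast
      ultimately show "f x = f u" by simp
    qed
  qed
  then show ?thesis using \<open>v \<in> L\<close> by simp
qed

section \<open>Counting clashes by codegrees\<close>

text \<open>A clash is a triple (u, v, w) with common right endpoint w. The two edges coincide
  exactly when u = v, so the diagonal is removed, costing K + 1 for each vertex of the
  intersection.\<close>

lemma card_clashes:
  assumes "S \<subseteq> L" "T \<subseteq> L"
  shows "real (card (clashes R E S T)) =
    (\<Sum>u\<in>S. \<Sum>v\<in>T. codeg u v) - (real K + 1) * real (card (S \<inter> T))"
proof -
  have fin: "finite S" "finite T"
    using assms fin_L finite_subset by auto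
  define P where "P = (SIGMA u:S. SIGMA v:T. {w \<in> R. u \<noteq> v \<and> {u, w} \<in> E \<and> {v, w} \<in> E})"
  define \<phi> where "\<phi> = (\<lambda>(u, v, w). ({u, w}, {v, w}) :: 'a set \<times> 'a set)"
  \<comment> \<open>Edges are unordered, but disjointness of \<open>L\<close> and \<open>R\<close>
    recovers which endpoint is which.\<close>
  have "inj_on \<phi> P"
    using assms disjoint by (fastforce simp: inj_on_def \<phi>_def P_def doubleton_eq_iff)
  moreover have "clashes R E S T = \<phi> ` P"
  proof (intro equalityI subsetI)
    fix x assume "x \<in> clashes R E S T"
    then obtain e e' where "x = (e, e')" "e \<in> edges_between E S R" "e' \<in> edges_between E T R" "e \<noteq> e'"
      and "\<exists>z\<in>R. z \<in> e \<and> z \<in> e'"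
      by (auto simp: clashes_def)
    moreover from this obtain u w v w' z where "e = {u, w}" "e' = {v, w'}" "u \<in> S" "v \<in> T"
      "w \<in> R" "w' \<in> R" "z \<in> R" "z \<in> {u, w}" "z \<in> {v, w'}"
      unfolding edges_between_def by blast
    ultimately have x: "x = ({u, w}, {v, w'})" "u \<in> S" "v \<in> T" "w \<in> R" "w' \<in> R"
      "{u, w} \<in> E" "{v, w'} \<in> E" "{u, w} \<noteq> {v, w'}" "z \<in> R" "z \<in> {u, w}" "z \<in> {v, w'}"
      by (simp_all add: edges_between_def)
    then have "z = w" "z = w'" using assms disjoint by auto
    with x have "(u, v, w) \<in> P" "x = \<phi> (u, v, w)"
      by (auto simp: P_def \<phi>_def)
    then show "x \<in> \<phi> ` P" by blast
  next
    fix x assume "x \<in> \<phi> ` P"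
    then obtain u v w where "x = ({u, w}, {v, w})" "u \<in> S" "v \<in> T" "w \<in> R" "u \<noteq> v"
      "{u, w} \<in> E" "{v, w} \<in> E"
      by (auto simp: P_def \<phi>_def)
    then show "x \<in> clashes R E S T"
      by (auto simp: clashes_def edges_between_def doubleton_eq_iff)
  qed
  ultimately have "real (card (clashes R E S T)) = real (card P)"
    by (simp add: card_image)
  also have "\<dots> = (\<Sum>u\<in>S. \<Sum>v\<in>T. real (card {w \<in> R. u \<noteq> v \<and> {u, w} \<in> E \<and> {v, w} \<in> E}))"
    using fin fin_R by (simp add: P_def)
  also have "\<dots> = (\<Sum>u\<in>S. \<Sum>v\<in>T. codeg u v - (if u = v then codeg u v else 0))"
  proof (intro sum.cong refl)
    fix u v
    have "codeg u v = (\<Sum>w\<in>R. of_bool ({u, w} \<in> E \<and> {v, w} \<in> E))"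
      unfolding codeg_def adj_def by (intro sum.cong) auto
    then show "real (card {w \<in> R. u \<noteq> v \<and> {u, w} \<in> E \<and> {v, w} \<in> E}) =
        codeg u v - (if u = v then codeg u v else 0)"
      using fin_R by (cases "u = v") (simp_all add: sum_of_bool_eq Int_def)
  qed
  also have "\<dots> = (\<Sum>u\<in>S. \<Sum>v\<in>T. codeg u v) - (\<Sum>u\<in>S. if u \<in> T then codeg u u else 0)"
    using fin by (simp add: sum_subtractf)
  also have "(\<Sum>u\<in>S. if u \<in> T then codeg u u else 0) = (\<Sum>u\<in>S \<inter> T. codeg u u)"
    using fin by (simp add: sum.inter_restrict)
  also have "\<dots> = (\<Sum>u\<in>S \<inter> T. real K + 1)"
    using assms codeg_self by (intro sum.cong) auto
  finally show ?thesis by simp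
qed

section \<open>Spectral bound on mean-zero functions\<close>

text \<open>The bound comes from \<open>(\<surd>K \<plusminus> \<epsilon>)\<^sup>2 = (K + \<epsilon>\<^sup>2) \<plusminus> 2 \<surd>K \<epsilon>\<close>.\<close>

lemma mean_zero_eigenvalue:
  assumes conn: "connected_graph (L \<union> R) E"
    and exp: "biexpander L R E K k \<epsilon>"
    and supp: "\<And>v. v \<notin> L \<Longrightarrow> f v = 0" and mean: "sum f L = 0" and nz: "f \<noteq> (\<lambda>_. 0)"
    and eig: "kernel_op L codeg f = (\<lambda>v. \<mu> * f v)"
  shows "\<bar>\<mu> - (real K + \<epsilon>\<^sup>2)\<bar> \<le> 2 * sqrt (real K) * \<epsilon>"
proof -
  let ?r = "sqrt (real K)" and ?t = "sqrt ((real K + 1) * (real k + 1))"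
  have e: "\<epsilon> < ?r" "excess L E = 0"
    using exp by (auto simp: biexpander_def)
  obtain s where s: "s > 0" "\<mu> = s\<^sup>2" "complex_of_real s \<in> adjacency_spectrum (L \<union> R) E"
    using codeg_eigenvalue[OF e(2) supp nz eig] by blast
  have "complex_of_real s \<in> complex_of_real `
       ({0} \<union> {?r - \<epsilon> .. ?r + \<epsilon>} \<union> uminus ` {?r - \<epsilon> .. ?r + \<epsilon>} \<union> {?t, - ?t})"
    using exp s(3) by (auto simp only: biexpander_def)
  then have "s \<in> {0} \<union> {?r - \<epsilon> .. ?r + \<epsilon>} \<union> uminus ` {?r - \<epsilon> .. ?r + \<epsilon>} \<union> {?t, - ?t}"
    by (elim imageE) (simp only: of_real_eq_iff)
  \<comment> \<open>At the top eigenvalue f would be constant on \<open>L\<close>, and a nonzero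
    constant does not have mean zero.\<close>
  moreover have "s \<noteq> ?t"
  proof
    assume "s = ?t"
    then have "\<mu> = (real K + 1) * (real k + 1)"
      using s(2) by simp
    then have const: "f v = f u" if "u \<in> L" "v \<in> L" for u v
      using top_eigenvector_const[OF conn _ that] eig by simp
    obtain u where u: "u \<in> L" "f u \<noteq> 0"
      using nz supp by blast
    have "sum f L = (\<Sum>v\<in>L. f u)"
      using const[OF u(1)] by (intro sum.cong) auto
    then show False
      using mean u fin_L by auto
  qed
  moreover have "- ?t \<le> 0" by simp
  \<comment> \<open>Positivity of \<open>s\<close> excludes 0, \<open>- ?t\<close> and the negative
    band, the latter because \<epsilon> < sqrt K.\<close>
  ultimately have "s \<in> {?r - \<epsilon> .. ?r + \<epsilon>}"
    using s(1) e(1) by auto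
  then have "(?r - \<epsilon>)\<^sup>2 \<le> s\<^sup>2" "s\<^sup>2 \<le> (?r + \<epsilon>)\<^sup>2"
    using e(1) s(1) by (auto intro!: power_mono)
  then show ?thesis
    by (simp add: s(2) power2_diff power2_sum abs_le_iff)
qed

text \<open>Subtracting c = K + \<epsilon>^2, the midpoint between (sqrt K - \<epsilon>)^2 and (sqrt
  K + \<epsilon>)^2, from the diagonal centres the eigenvalues at 0. Then
  \<open>kernel_op_bound\<close> applies to the shifted kernel on the mean-zero space
  \<open>W\<close>.\<close>

lemma mean_zero_bound:
  assumes conn: "connected_graph (L \<union> R) E"
    and exp: "biexpander L R E K k \<epsilon>"
    and f: "\<And>v. v \<notin> L \<Longrightarrow> f v = 0" "sum f L = 0"
    and g: "\<And>v. v \<notin> L \<Longrightarrow> g v = 0" "sum g L = 0"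
  shows "\<bar>inner_on L (kernel_op L codeg f) g - (real K + \<epsilon>\<^sup>2) * inner_on L f g\<bar>
    \<le> 2 * sqrt (real K) * \<epsilon> * sqrt (inner_on L f f * inner_on L g g)"
proof -
  define c where "c = real K + \<epsilon>\<^sup>2"
  define m where "m u v = codeg u v - (if u = v then c else 0)" for u v
  define W :: "('a \<Rightarrow> real) set" where "W = {f. (\<forall>v. v \<notin> L \<longrightarrow> f v = 0) \<and> sum f L = 0}"
  have m_op: "kernel_op L m h v = kernel_op L codeg h v - c * h v" if "h \<in> W" for h v
  proof (cases "v \<in> L")
    case True
    have "kernel_op L m h v = (\<Sum>u\<in>L. codeg v u * h u - (if v = u then c * h u else 0))"
      using True by (auto simp: kernel_op_def m_def algebra_simps intro!: sum.cong)
    also have "\<dots> = kernel_op L codeg h v - c * h v"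
      using True fin_L by (simp add: kernel_op_def sum_subtractf)
    finally show ?thesis .
  next
    case False
    then show ?thesis using that by (simp add: kernel_op_def W_def)
  qed
  have "closed W"
  proof -
    have "closed {f :: 'a \<Rightarrow> real. v \<notin> L \<longrightarrow> f v = 0}" for v
      by (cases "v \<in> L") (simp_all add: closed_Collect_eq continuous_on_eval)
    then show ?thesis
      unfolding W_def
      by (intro closed_Collect_conj closed_Collect_all closed_Collect_eq continuous_on_sum
            continuous_on_eval continuous_on_const)
  qed
  \<comment> \<open>Column sums of \<open>codeg\<close> are constant by symmetry, so the total of
    the image is a multiple of the total of \<open>h\<close>, which is 0.\<close>
  have "kernel_op L m h \<in> W" if h: "h \<in> W" for h
  proof -
    have "sum (kernel_op L codeg h) L = (\<Sum>v\<in>L. \<Sum>u\<in>L. codeg v u * h u)"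
      by (simp add: kernel_op_def)
    also have "\<dots> = (\<Sum>u\<in>L. (\<Sum>v\<in>L. codeg u v) * h u)"
      by (subst sum.swap) (simp add: sum_distrib_right codeg_commute)
    also have "\<dots> = 0"
      using h by (simp add: codeg_row_sum W_def flip: sum_distrib_left)
    finally have "sum (kernel_op L m h) L = 0"
      using h by (simp add: m_op[OF h] W_def sum_subtractf flip: sum_distrib_left)
    then show ?thesis
      by (simp add: W_def kernel_op_def)
  qed
  moreover have "\<bar>x\<bar> \<le> 2 * sqrt (real K) * \<epsilon>"
    if h: "h \<in> W" "h \<noteq> (\<lambda>_. 0)" and x: "kernel_op L m h = (\<lambda>v. x * h v)" for h x
  proof -
    have "kernel_op L codeg h v = (x + c) * h v" for v
      using m_op[OF h(1), of v] fun_cong[OF x, of v] by (simp add: algebra_simps)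
    then have "kernel_op L codeg h = (\<lambda>v. (x + c) * h v)"
      by blast
    from mean_zero_eigenvalue[OF conn exp _ _ h(2) this] show ?thesis
      using h(1) by (simp add: W_def c_def)
  qed
  moreover have "f \<in> W" "g \<in> W"
    using f g by (auto simp: W_def)
  moreover have "(\<lambda>v. a * f v + b * g v) \<in> W" if "f \<in> W" "g \<in> W" for a b f g
    using that by (simp add: W_def sum.distrib flip: sum_distrib_left)
  moreover have "m u v = m v u" for u v
    by (simp add: m_def codeg_commute)
  moreover have "h v = 0" if "h \<in> W" "v \<notin> L" for h v
    using that by (simp add: W_def)
  ultimately have
    "\<bar>inner_on L (kernel_op L m f) g\<bar> \<le> 2 * sqrt (real K) * \<epsilon> * sqrt (inner_on L f f * inner_on L g g)"
    by (intro kernel_op_bound[OF fin_L _ _ \<open>closed W\<close>])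
  moreover have "inner_on L (kernel_op L m f) g
      = inner_on L (kernel_op L codeg f) g - c * inner_on L f g"
    unfolding inner_on_def m_op[OF \<open>f \<in> W\<close>]
    by (simp add: algebra_simps sum_subtractf sum_distrib_left)
  ultimately show ?thesis
    by (simp add: c_def)
qed

section \<open>Mixing estimate and the bound on clashes\<close>

text \<open>Each indicator splits into its density times the constant 1 and a mean-zero part. Cross
  terms vanish, and the constants contribute (K+1)(k+1)|S||T|/n. The mean-zero parts have inner
  product |S \<inter> T| - |S||T|/n; multiplying this by c explains the coefficient with c
  subtracted.\<close>

lemma expander_mixing:
  assumes conn: "connected_graph (L \<union> R) E"
    and exp: "biexpander L R E K k \<epsilon>"
    and S: "S \<subseteq> L" and T: "T \<subseteq> L" and ne: "L \<noteq> {}"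
  defines "n \<equiv> real (card L)" and "c \<equiv> real K + \<epsilon>\<^sup>2"
  shows "\<bar>(\<Sum>u\<in>S. \<Sum>v\<in>T. codeg u v)
      - (((real K + 1) * (real k + 1) - c) / n * real (card S) * real (card T)
         + c * real (card (S \<inter> T)))\<bar>
    \<le> 2 * sqrt (real K) * \<epsilon> *
        sqrt (real (card S) * (1 - real (card S) / n) * (real (card T) * (1 - real (card T) / n)))"
proof -
  let ?D = "(real K + 1) * (real k + 1)"
  let ?M = "kernel_op L codeg"
  define one where "one v = (if v \<in> L then 1 else 0 :: real)" for v
  define ind where "ind A v = (if v \<in> A then 1 else 0 :: real)" for A :: "'a set" and v
  define d where "d A = real (card A) / n" for A :: "'a set"
  define f where "f A v = ind A v - d A * one v" for A v
  have n: "n > 0"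
    using ne fin_L by (simp add: n_def card_gt_0_iff)
  have f_supp: "f A v = 0" if "A \<subseteq> L" "v \<notin> L" for A v
    using that by (auto simp: f_def one_def ind_def)
  have sum_ind: "sum (ind A) L = real (card A)" if "A \<subseteq> L" for A
    using that fin_L by (simp add: ind_def sum.If_cases Int_absorb1)
  have f_mean: "sum (f A) L = 0" if "A \<subseteq> L" for A
    using sum_ind[OF that] n
    by (simp add: f_def sum_subtractf one_def d_def flip: n_def sum_distrib_left)
  have ind: "ind A = (\<lambda>v. 1 * f A v + d A * one v)" for A
    by (simp add: f_def)
  have inner_one: "inner_on L h one = sum h L" "inner_on L one h = sum h L" for h
    by (simp_all add: inner_on_def one_def)
  have M_one: "?M one = (\<lambda>v. ?D * one v + 0 * one v)"
    by (auto simp: kernel_op_def one_def codeg_row_sum)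
  have inner_ind: "inner_on L (ind A) (ind B) = real (card (A \<inter> B))" if "A \<subseteq> L" for A B
  proof -
    have "inner_on L (ind A) (ind B) = sum (ind (A \<inter> B)) L"
      unfolding inner_on_def by (intro sum.cong) (auto simp: ind_def)
    then show ?thesis using sum_ind[of "A \<inter> B"] that by auto
  qed
  have sum_one: "sum one L = n" by (simp add: one_def n_def)
  have inner_f: "inner_on L (f A) (f B) = real (card (A \<inter> B)) - d A * d B * n"
    if "A \<subseteq> L" "B \<subseteq> L" for A B
    using inner_ind[OF that(1), of B]
    unfolding ind[of A] ind[of B] inner_on_lin inner_one f_mean[OF that(1)] f_mean[OF that(2)] sum_one
    by simp
  have inner_Mf_one: "inner_on L (?M (f A)) one = 0" if "A \<subseteq> L" for A
    unfolding inner_on_kernel_op[OF codeg_commute] M_one inner_on_lin inner_one f_mean[OF that]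
    by simp
  have "inner_on L (?M (ind S)) (ind T)
      = inner_on L (?M (f S)) (f T) + d S * d T * ?D * n"
    unfolding ind[of S] ind[of T] kernel_op_lin M_one inner_on_lin inner_Mf_one[OF S] inner_one(2)
      f_mean[OF T] sum_one
    by simp
  moreover have "inner_on L (?M (ind S)) (ind T) = (\<Sum>u\<in>S. \<Sum>v\<in>T. codeg u v)"
  proof -
    have sum_mult_ind: "(\<Sum>v\<in>L. h v * ind A v) = sum h A" if "A \<subseteq> L" for A h
      using that fin_L by (simp add: ind_def if_distrib sum.If_cases Int_absorb1 cong: if_cong)
    have "inner_on L (?M (ind S)) (ind T) = (\<Sum>v\<in>T. ?M (ind S) v)"
      by (simp add: inner_on_def sum_mult_ind T)
    also have "\<dots> = (\<Sum>v\<in>T. \<Sum>u\<in>S. codeg v u)"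
      using T by (intro sum.cong) (auto simp: kernel_op_def sum_mult_ind S)
    finally show ?thesis
      by (subst sum.swap) (simp add: codeg_commute)
  qed
  ultimately have sum_eq: "(\<Sum>u\<in>S. \<Sum>v\<in>T. codeg u v) = inner_on L (?M (f S)) (f T) + d S * d T * ?D * n"
    by simp
  \<comment> \<open>The squared norm is |A| - |A|^2/n, the source of the factors under the
    root.\<close>
  have norm: "inner_on L (f A) (f A) = real (card A) * (1 - real (card A) / n)" if "A \<subseteq> L" for A
    using inner_f[OF that that] n by (simp add: d_def field_simps)
  have "(?D - c) / n * real (card S) * real (card T) = (?D - c) * (d S * d T * n)"
    using n by (simp add: d_def)
  then have "(\<Sum>u\<in>S. \<Sum>v\<in>T. codeg u v)
      - ((?D - c) / n * real (card S) * real (card T) + c * real (card (S \<inter> T)))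
      = inner_on L (?M (f S)) (f T) - c * inner_on L (f S) (f T)"
    unfolding sum_eq inner_f[OF S T] by (simp add: algebra_simps)
  then show ?thesis
    using mean_zero_bound[OF conn exp f_supp[OF S] f_mean[OF S] f_supp[OF T] f_mean[OF T]]
    unfolding norm[OF S] norm[OF T] c_def by simp
qed

end

theorem theorem4p3:
  fixes L R S T :: "'a set" and E :: "'a set set" and K k n :: nat and \<epsilon> :: real
  assumes "k \<ge> 1" and "K > k"
    and "finite L" and "finite R"
    and "bipartite_graph L R E"
    and "biregular L R E (K + 1) (k + 1)"
    and "connected_graph (L \<union> R) E"
    and "card L = n"
    and "biexpander L R E K k \<epsilon>"
    and "S \<subseteq> L" and "T \<subseteq> L"
  shows "\<bar>real (card (clashes R E S T))
            - ((real K * real k + real k + 1 - \<epsilon>\<^sup>2) / real n * real (card S) * real (card T)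
               + (\<epsilon>\<^sup>2 - 1) * real (card (S \<inter> T)))\<bar>
         \<le> 2 * sqrt (real K) * \<epsilon> *
             sqrt (real (card S) * (1 - real (card S) / real n)
                   * (real (card T) * (1 - real (card T) / real n)))"
proof -
  interpret biregular_bipartite L R E K k
    using assms by unfold_locales
  \<comment> \<open>With \<open>L\<close> empty there are no edges, but connectedness leaves a
    vertex in \<open>R\<close>, whose degree k + 1 is positive.\<close>
  have "L \<noteq> {}"
  proof
    assume "L = {}"
    then have "vertex_degree E v = 0" for v
      using assms(5) by (auto simp: vertex_degree_def bipartite_graph_def)
    moreover obtain v where "v \<in> R"
      using assms(7) \<open>L = {}\<close> by (auto simp: connected_graph_def)
    ultimately show False
      using assms(6) by (auto simp: biregular_def)
  qed
  \<comment> \<open>This is the coefficient of |S||T|/n. For |S \<inter> T|, removing the diagonal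
    turns K + \<epsilon>^2 into K + \<epsilon>^2 - (K + 1) = \<epsilon>^2 - 1.\<close>
  have "(real K + 1) * (real k + 1) - (real K + \<epsilon>\<^sup>2) = real K * real k + real k + 1 - \<epsilon>\<^sup>2"
    by (simp add: algebra_simps)
  then show ?thesis
    using expander_mixing[OF assms(7,9,10,11) \<open>L \<noteq> {}\<close>] assms(8)
    by (simp add: card_clashes[OF assms(10,11)] algebra_simps)
qed

end
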